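(* There exist finite non-null (i.e. having at least one edge) primitive graphs admitting non-uniform endomorphisms; hence not every primitive permutation group is almost synchronizing.
   Context: Graphs are finite, simple and undirected; an endomorphism of a graph is a map from the vertex set to itself sending edges to edges. A permutation group $G$ on a finite set $\Omega$ is primitive if it is transitive and preserves no equivalence relation on $\Omega$ other than equality and the universal relation. A primitive graph is a graph admitting a group of automorphisms that acts primitively on its vertices. The kernel of a map $f:\Omega\to\Omega$ is the partition of $\Omega$ given by $x\equiv y \iff xf=yf$ (maps are written on the right); $f$ is uniform if all kernel classes have the same size, and non-uniform otherwise. $G$ synchronizes $f$ if the transformation semigroup $\langle G,f\rangle$ contains a constant map. A primitive group is almost synchronizing if it synchronizes every non-uniform transformation of $\Omega$. *)

theory Defs
  imports
    "Graph_Theory.Pair_Digraph"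
    "HOL-Algebra.Bij"
    "HOL-Algebra.Group_Action"
begin

text \<open>
  A finite simple undirected graph is a \<^locale>\<open>pair_graph\<close>: a finite, loop-free digraph
  without parallel arcs whose arc set is symmetric. An undirected edge is thus represented by
  its two orientations.

  Maps from a set to itself are extensional functions (undefined outside the set), so that
  composition of permutations is the multiplication of \<^const>\<open>BijGroup\<close> and composition of
  arbitrary transformations is \<^const>\<open>compose\<close>. Maps are written on the left; this does not
  affect the group or semigroup generated by a set of maps.
\<close>

abbreviation transformations :: "'a set \<Rightarrow> ('a \<Rightarrow> 'a) set" where
  "transformations \<Omega> \<equiv> \<Omega> \<rightarrow>\<^sub>E \<Omega>"

definition permutation_group :: "'a set \<Rightarrow> ('a \<Rightarrow> 'a) set \<Rightarrow> bool" where
  "permutation_group \<Omega> G \<longleftrightarrow> finite \<Omega> \<and> subgroup G (BijGroup \<Omega>)"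

definition preserves_relation :: "('a \<Rightarrow> 'a) set \<Rightarrow> 'a rel \<Rightarrow> bool" where
  "preserves_relation G r \<longleftrightarrow> (\<forall>g\<in>G. \<forall>(x, y)\<in>r. (g x, g y) \<in> r)"

definition primitive_group :: "'a set \<Rightarrow> ('a \<Rightarrow> 'a) set \<Rightarrow> bool" where
  "primitive_group \<Omega> G \<longleftrightarrow>
     permutation_group \<Omega> G \<and>
     transitive_action (BijGroup \<Omega> \<lparr>carrier := G\<rparr>) \<Omega> (\<lambda>g. g) \<and>
     (\<forall>r. equiv \<Omega> r \<and> preserves_relation G r \<longrightarrow> r = Id_on \<Omega> \<or> r = \<Omega> \<times> \<Omega>)"

definition endomorphisms :: "'a pair_pre_digraph \<Rightarrow> ('a \<Rightarrow> 'a) set" where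
  "endomorphisms \<Gamma> =
     {f \<in> transformations (pverts \<Gamma>). \<forall>(x, y)\<in>parcs \<Gamma>. (f x, f y) \<in> parcs \<Gamma>}"

definition automorphisms :: "'a pair_pre_digraph \<Rightarrow> ('a \<Rightarrow> 'a) set" where
  "automorphisms \<Gamma> =
     {g \<in> Bij (pverts \<Gamma>).
        \<forall>x\<in>pverts \<Gamma>. \<forall>y\<in>pverts \<Gamma>. (g x, g y) \<in> parcs \<Gamma> \<longleftrightarrow> (x, y) \<in> parcs \<Gamma>}"

definition primitive_graph :: "'a pair_pre_digraph \<Rightarrow> bool" where
  "primitive_graph \<Gamma> \<longleftrightarrow>
     pair_graph \<Gamma> \<and> (\<exists>G. G \<subseteq> automorphisms \<Gamma> \<and> primitive_group (pverts \<Gamma>) G)"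

definition non_null :: "'a pair_pre_digraph \<Rightarrow> bool" where
  "non_null \<Gamma> \<longleftrightarrow> parcs \<Gamma> \<noteq> {}"

definition kernel_partition :: "'a set \<Rightarrow> ('a \<Rightarrow> 'a) \<Rightarrow> 'a set set" where
  "kernel_partition \<Omega> f = \<Omega> // {(x, y) \<in> \<Omega> \<times> \<Omega>. f x = f y}"

definition uniform :: "'a set \<Rightarrow> ('a \<Rightarrow> 'a) \<Rightarrow> bool" where
  "uniform \<Omega> f \<longleftrightarrow>
     (\<forall>A\<in>kernel_partition \<Omega> f. \<forall>B\<in>kernel_partition \<Omega> f. card A = card B)"

inductive_set transformation_semigroup :: "'a set \<Rightarrow> ('a \<Rightarrow> 'a) set \<Rightarrow> ('a \<Rightarrow> 'a) set"
  for \<Omega> :: "'a set" and S :: "('a \<Rightarrow> 'a) set" where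
  generator: "s \<in> S \<Longrightarrow> s \<in> transformation_semigroup \<Omega> S"
| product: "s \<in> transformation_semigroup \<Omega> S \<Longrightarrow> t \<in> transformation_semigroup \<Omega> S \<Longrightarrow>
    compose \<Omega> s t \<in> transformation_semigroup \<Omega> S"

definition synchronizes :: "'a set \<Rightarrow> ('a \<Rightarrow> 'a) set \<Rightarrow> ('a \<Rightarrow> 'a) \<Rightarrow> bool" where
  "synchronizes \<Omega> G f \<longleftrightarrow>
     (\<exists>h\<in>transformation_semigroup \<Omega> (insert f G). \<exists>c\<in>\<Omega>. \<forall>x\<in>\<Omega>. h x = c)"

definition almost_synchronizing :: "'a set \<Rightarrow> ('a \<Rightarrow> 'a) set \<Rightarrow> bool" where
  "almost_synchronizing \<Omega> G \<longleftrightarrow>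
     (\<forall>f\<in>transformations \<Omega>. \<not> uniform \<Omega> f \<longrightarrow> synchronizes \<Omega> G f)"

end

theory Submission
  imports Defs "HOL-Library.Nat_Bijection" "HOL-Combinatorics.Permutations"
begin

text \<open>
  The witness is a graph on 45 vertices. Let \<open>T\<close> be a connected bipartite cubic graph and let
  \<open>L\<close> be its line graph: each vertex of \<open>T\<close> becomes a triangle of \<open>L\<close>, and each
  edge \<open>c\<close> of \<open>T\<close> becomes a vertex of \<open>L\<close> at which two triangles
  \<open>{c, a, a'}\<close> and \<open>{c, b, b'}\<close> meet, a "butterfly". Choose a perfect matching \<open>M\<close> of
  \<open>T\<close> and delete it; what remains is a disjoint union of cycles, all of even length. Send every
  edge in \<open>M\<close> to \<open>c\<close>, and map the edges of each remaining cycle alternately to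
  \<open>a\<close> and \<open>a'\<close>, or alternately to \<open>b\<close> and \<open>b'\<close>, where
  the choice may depend on the cycle. This sends triangles to triangles, so it is an endomorphism
  of \<open>L\<close>. If there is more than one cycle and both wings are used, the fibre of \<open>c\<close> contains a
  third of the vertices and the other fibres cannot all be as large. Thus it suffices that the automorphism
  group of \<open>T\<close> is primitive on edges and that deleting some perfect matching disconnects \<open>T\<close>.
  The Tutte-Coxeter graph, the cubic cage of girth 8, has both properties.

  Its line graph is described here through the projective line over the field with nine elements.
  The images of the projective line over the prime field are 30 blocks of size 4 which form the
  Steiner system S(3,4,10), the inversive plane of order 3. The vertices of the graph are the 45
  pairs of points, and two pairs are adjacent when their union is a block (equivalently, when they
  separate each other harmonically). The points can be labelled by the integers modulo 10 so that
  the blocks are the translates of three base blocks.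

  Primitivity comes from \<open>triply_transitive\<close>: the permutations preserving the blocks act
  3-transitively on the points. If an invariant equivalence relates two distinct pairs that share a
  point, then by 3-transitivity it relates all pairs that share a point, and hence all pairs.
  If it relates two disjoint pairs, then 3-transitivity moves them to \<open>{0, 5}\<close> and
  \<open>{1, x}\<close>, and permutations fixing \<open>{0, 5}\<close> reduce each of the seven values of
  \<open>x\<close> to the case of a shared point (\<open>invariant_equivalence_total\<close>).

  For the endomorphism (\<open>fold_pair\<close>), the deleted matching leaves a 10-cycle and a 20-cycle;
  the fibres have sizes 15, 10, 10, 5 and 5. Finally, no group of automorphisms of a graph with an edge
  synchronizes an endomorphism: every product is again an endomorphism, and a constant map would turn an
  edge into a loop (\<open>endomorphism_not_synchronized\<close>). So the first assertion implies the second.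
\<close>

section \<open>Automorphisms and endomorphisms of graphs\<close>

lemma subgroup_automorphisms: "subgroup (automorphisms \<Gamma>) (BijGroup (pverts \<Gamma>))"
proof (rule group.subgroupI[OF group_BijGroup])
  show "automorphisms \<Gamma> \<subseteq> carrier (BijGroup (pverts \<Gamma>))"
    by (auto simp: automorphisms_def BijGroup_def)
  have "(\<lambda>x\<in>pverts \<Gamma>. x) \<in> automorphisms \<Gamma>"
    by (simp add: automorphisms_def id_Bij)
  then show "automorphisms \<Gamma> \<noteq> {}" by blast
next
  fix g assume g: "g \<in> automorphisms \<Gamma>"
  let ?k = "inv_into (pverts \<Gamma>) g"
  have bij: "bij_betw g (pverts \<Gamma>) (pverts \<Gamma>)"
    using g by (simp add: automorphisms_def Bij_def)
  have "(?k x, ?k y) \<in> parcs \<Gamma> \<longleftrightarrow> (x, y) \<in> parcs \<Gamma>"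
    if "x \<in> pverts \<Gamma>" "y \<in> pverts \<Gamma>" for x y
  proof -
    have "?k x \<in> pverts \<Gamma>" "?k y \<in> pverts \<Gamma>"
      using that bij by (auto simp: bij_betw_def inv_into_into)
    then have "(g (?k x), g (?k y)) \<in> parcs \<Gamma> \<longleftrightarrow> (?k x, ?k y) \<in> parcs \<Gamma>"
      using g by (simp add: automorphisms_def)
    then show ?thesis using that bij by (simp add: bij_betw_inv_into_right)
  qed
  then show "inv\<^bsub>BijGroup (pverts \<Gamma>)\<^esub> g \<in> automorphisms \<Gamma>"
    using g by (simp add: automorphisms_def inv_BijGroup restrict_inv_into_Bij)
next
  fix g k assume "g \<in> automorphisms \<Gamma>" "k \<in> automorphisms \<Gamma>"
  then show "g \<otimes>\<^bsub>BijGroup (pverts \<Gamma>)\<^esub> k \<in> automorphisms \<Gamma>"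
    by (auto simp: automorphisms_def BijGroup_def compose_Bij compose_eq Bij_imp_funcset[THEN funcset_mem])
qed

text \<open>
  A group of automorphisms acting primitively can be taken to be the full automorphism group, so that
  only its transitivity and its invariant equivalences are left to study.
\<close>

lemma primitive_graphI:
  assumes graph: "pair_graph \<Gamma>"
    and trans: "\<And>x y. x \<in> pverts \<Gamma> \<Longrightarrow> y \<in> pverts \<Gamma> \<Longrightarrow> \<exists>g\<in>automorphisms \<Gamma>. g x = y"
    and prim: "\<And>r. equiv (pverts \<Gamma>) r \<Longrightarrow> preserves_relation (automorphisms \<Gamma>) r \<Longrightarrow>
                 r \<noteq> Id_on (pverts \<Gamma>) \<Longrightarrow> r = pverts \<Gamma> \<times> pverts \<Gamma>"
  shows "primitive_graph \<Gamma>"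
proof -
  let ?G = "automorphisms \<Gamma>" and ?B = "BijGroup (pverts \<Gamma>)"
  interpret pair_graph \<Gamma> by (rule graph)
  interpret B: group ?B by (rule group_BijGroup)
  have sub: "subgroup ?G ?B" by (rule subgroup_automorphisms)
  have "group_hom (?B\<lparr>carrier := ?G\<rparr>) ?B (\<lambda>g. g)"
    using subgroup.subset[OF sub] B.subgroup_imp_group[OF sub]
    by (auto simp: group_hom_def group_hom_axioms_def hom_def group_BijGroup)
  then have "transitive_action (?B\<lparr>carrier := ?G\<rparr>) (pverts \<Gamma>) (\<lambda>g. g)"
    using trans by (auto simp: transitive_action_def transitive_action_axioms_def group_action_def)
  then have "primitive_group (pverts \<Gamma>) ?G"
    using sub pair_finite_verts prim by (auto simp: primitive_group_def permutation_group_def)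
  then show ?thesis using graph by (auto simp: primitive_graph_def)
qed

lemma endomorphisms_compose:
  assumes "f \<in> endomorphisms \<Gamma>" "g \<in> endomorphisms \<Gamma>" "pair_graph \<Gamma>"
  shows "compose (pverts \<Gamma>) f g \<in> endomorphisms \<Gamma>"
proof -
  interpret pair_graph \<Gamma> by fact
  have "compose (pverts \<Gamma>) f g \<in> transformations (pverts \<Gamma>)"
    using assms by (auto simp: endomorphisms_def PiE_def compose_def)
  moreover have "(compose (pverts \<Gamma>) f g x, compose (pverts \<Gamma>) f g y) \<in> parcs \<Gamma>"
    if "(x, y) \<in> parcs \<Gamma>" for x y
    using assms that in_arcsD1[OF that] in_arcsD2[OF that]
    by (auto simp: endomorphisms_def compose_eq)
  ultimately show ?thesis by (auto simp: endomorphisms_def)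
qed

lemma automorphisms_subset_endomorphisms:
  assumes "pair_graph \<Gamma>"
  shows "automorphisms \<Gamma> \<subseteq> endomorphisms \<Gamma>"
proof -
  interpret pair_graph \<Gamma> by fact
  show ?thesis
    by (auto simp: automorphisms_def endomorphisms_def PiE_def Bij_imp_extensional
        dest: in_arcsD1 in_arcsD2 Bij_imp_funcset)
qed

text \<open>
  Endomorphisms are closed under composition, and a constant map is not one of them because it would
  collapse an edge to a loop.
\<close>

lemma endomorphism_not_synchronized:
  assumes graph: "pair_graph \<Gamma>" and "non_null \<Gamma>"
    and G: "G \<subseteq> automorphisms \<Gamma>" and f: "f \<in> endomorphisms \<Gamma>"
  shows "\<not> synchronizes (pverts \<Gamma>) G f"
proof
  interpret pair_graph \<Gamma> by (rule graph)
  assume "synchronizes (pverts \<Gamma>) G f"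
  then obtain h c where h: "h \<in> transformation_semigroup (pverts \<Gamma>) (insert f G)"
    and const: "\<forall>x\<in>pverts \<Gamma>. h x = c"
    by (auto simp: synchronizes_def)
  from h have "h \<in> endomorphisms \<Gamma>"
    by induction (use G f automorphisms_subset_endomorphisms[OF graph]
        endomorphisms_compose[OF _ _ graph] in auto)
  moreover obtain x y where "(x, y) \<in> parcs \<Gamma>"
    using \<open>non_null \<Gamma>\<close> by (auto simp: non_null_def)
  moreover from this have "h x = h y"
    using const in_arcsD1 in_arcsD2 by metis
  ultimately have "(h x, h x) \<in> parcs \<Gamma>"
    by (auto simp: endomorphisms_def)
  then show False using pair_no_loops by fastforce
qed

section \<open>The Steiner system S(3,4,10) and its automorphisms\<close>

text \<open>
  The points are the integers modulo 10. Outside \<open>{..<10}\<close> the maps below are the identity, so that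
  they are permutations in the sense of \<^const>\<open>permutes\<close>.
\<close>

definition rot :: "nat \<Rightarrow> nat \<Rightarrow> nat" where
  "rot k x = (if x < 10 then (x + k) mod 10 else x)"

definition translates :: "nat set \<Rightarrow> nat set set" where
  "translates B = (\<lambda>k. rot k ` B) ` {..<10}"

definition blocks :: "nat set set" where
  "blocks = translates {0, 1, 3, 4} \<union> translates {0, 1, 2, 6} \<union> translates {0, 2, 4, 7}"

definition mul3 :: "nat \<Rightarrow> nat" where
  "mul3 x = (if x < 10 then 3 * x mod 10 else x)"

text \<open>
  The analogue of inversion in a circle for the block \<open>{0, 1, 5, 9}\<close>: the nontrivial automorphism
  fixing this block pointwise. Unlike \<^const>\<open>rot\<close> and \<^const>\<open>mul3\<close>, it is not an
  affine map modulo 10, and it is what makes the group 3-transitive.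
\<close>

definition inversion :: "nat \<Rightarrow> nat" where
  "inversion = transpose 2 8 \<circ> transpose 3 4 \<circ> transpose 6 7"

definition block_perms :: "(nat \<Rightarrow> nat) set" where
  "block_perms = {\<pi>. \<pi> permutes {..<10} \<and> (`) \<pi> ` blocks = blocks}"

lemma lessThan_10: "{..<10::nat} = {0, 1, 2, 3, 4, 5, 6, 7, 8, 9}"
  by (simp add: lessThan_nat_numeral lessThan_Suc insert_commute)

lemma translates_eq:
  "translates B = {rot 0 ` B, rot 1 ` B, rot 2 ` B, rot 3 ` B, rot 4 ` B,
                   rot 5 ` B, rot 6 ` B, rot 7 ` B, rot 8 ` B, rot 9 ` B}"
  by (simp add: translates_def lessThan_10)

lemmas blocks_eq = blocks_def[unfolded translates_eq]

text \<open>
  The same finite set can be enumerated in several orders, but its code is a single numeral. Comparing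
  codes therefore decides whether an explicitly given set is a block.
\<close>

lemma block_encode:
  assumes "finite B" "set_encode B \<in> set_encode ` blocks"
  shows "B \<in> blocks"
proof -
  have "finite C" if "C \<in> blocks" for C using that by (auto simp: blocks_def translates_def)
  with assms show ?thesis by (auto simp: set_encode_eq)
qed

text \<open>
  Rewriting compares these sets element by element, so the numerals 1 and 2 must be kept out of
  successor form here and in the checks below.
\<close>

lemma blocks_explicit:
  "blocks =
    {{0, 1, 3, 4}, {1, 2, 4, 5}, {2, 3, 5, 6}, {3, 4, 6, 7}, {4, 5, 7, 8},
     {5, 6, 8, 9}, {6, 7, 9, 0}, {7, 8, 0, 1}, {8, 9, 1, 2}, {9, 0, 2, 3},
     {0, 1, 2, 6}, {1, 2, 3, 7}, {2, 3, 4, 8}, {3, 4, 5, 9}, {4, 5, 6, 0},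
     {5, 6, 7, 1}, {6, 7, 8, 2}, {7, 8, 9, 3}, {8, 9, 0, 4}, {9, 0, 1, 5},
     {0, 2, 4, 7}, {1, 3, 5, 8}, {2, 4, 6, 9}, {3, 5, 7, 0}, {4, 6, 8, 1},
     {5, 7, 9, 2}, {6, 8, 0, 3}, {7, 9, 1, 4}, {8, 0, 2, 5}, {9, 1, 3, 6}}"
  unfolding blocks_eq Un_insert_left Un_empty_left by (simp add: rot_def numeral_2_eq_2[symmetric] del: One_nat_def)

lemma card_block: "B \<in> blocks \<Longrightarrow> card B = 4"
  unfolding blocks_explicit by (elim insertE emptyE) simp_all

lemma block_codes:
  "set_encode ` blocks = {27, 54, 108, 216, 432, 864, 705, 387, 774, 525, 71, 142, 284, 568, 113, 226, 452, 904, 785, 547, 149, 298, 596, 169, 338, 676, 329, 658, 293, 586}"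
  by (simp add: blocks_explicit del: One_nat_def)

text \<open>
  There are finitely many blocks and an injective map acts injectively on them, so mapping blocks to
  blocks already means permuting them.
\<close>

lemma block_permsI:
  assumes "\<pi> permutes {..<10}" "\<And>B. B \<in> blocks \<Longrightarrow> \<pi> ` B \<in> blocks"
  shows "\<pi> \<in> block_perms"
proof -
  have "finite blocks" by (simp add: blocks_def translates_def)
  moreover have "inj_on ((`) \<pi>) blocks"
    using assms(1) by (auto simp: inj_on_def inj_image_eq_iff dest: permutes_inj)
  ultimately have "(`) \<pi> ` blocks = blocks"
    using assms(2) by (intro endo_inj_surj) auto
  with assms(1) show ?thesis by (simp add: block_perms_def)
qed

lemma block_perms_comp:
  assumes "\<pi> \<in> block_perms" "\<sigma> \<in> block_perms"
  shows "\<pi> \<circ> \<sigma> \<in> block_perms"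
proof -
  have "(`) (\<pi> \<circ> \<sigma>) ` blocks = (`) \<pi> ` (`) \<sigma> ` blocks"
    by (simp add: image_image o_def)
  then show ?thesis using assms by (simp add: block_perms_def permutes_compose)
qed

lemma block_perms_inv:
  assumes "\<pi> \<in> block_perms" shows "inv_into UNIV \<pi> \<in> block_perms"
proof -
  have p: "\<pi> permutes {..<10}" and b: "(`) \<pi> ` blocks = blocks"
    using assms by (auto simp: block_perms_def)
  have "(`) (inv_into UNIV \<pi>) ` blocks = (`) (inv_into UNIV \<pi>) ` (`) \<pi> ` blocks" by (simp add: b)
  also have "\<dots> = blocks"
    by (simp add: image_image permutes_inverses(2)[OF p])
  finally show ?thesis using p by (simp add: block_perms_def permutes_inv)
qed

lemma rot_rot: "rot k (rot i x) = rot ((k + i) mod 10) x"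
  by (simp add: rot_def mod_add_left_eq mod_add_right_eq add_ac)

lemma rot_image_translates: "B \<in> translates C \<Longrightarrow> rot k ` B \<in> translates C"
proof -
  assume "B \<in> translates C"
  then obtain i where "B = rot i ` C" unfolding translates_def by blast
  then have "rot k ` B = rot ((k + i) mod 10) ` C" by (simp add: image_image rot_rot)
  then show ?thesis by (simp add: translates_def)
qed

lemma rot_block_perm: "rot k \<in> block_perms"
proof (rule block_permsI)
  have "rot (10 - k mod 10) (rot k x) = x" if "x < 10" for x
  proof -
    have "(10 - k mod 10 + k) mod 10 = 0" by presburger
    then show ?thesis using that by (simp only: rot_rot) (simp add: rot_def)
  qed
  then have "inj_on (rot k) {..<10}" by (intro inj_on_inverseI[where g = "rot (10 - k mod 10)"]) simp
  moreover have "rot k ` {..<10} \<subseteq> {..<10}" by (auto simp: rot_def)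
  ultimately have "bij_betw (rot k) {..<10} {..<10}"
    by (simp add: bij_betw_def endo_inj_surj)
  then show "rot k permutes {..<10}"
    by (rule bij_imp_permutes) (simp add: rot_def)
next
  show "rot k ` B \<in> blocks" if "B \<in> blocks" for B
    using that by (auto simp: blocks_def rot_image_translates)
qed

text \<open>
  Multiplication by 3 normalises the translations, which reduces the claim about \<^const>\<open>mul3\<close> to the
  three base blocks. The inversion has no such relation to the translations, and all 30 blocks are checked.
\<close>

lemma mul3_block_perm: "mul3 \<in> block_perms"
proof (rule block_permsI)
  have "bij_betw mul3 {..<10} {..<10}"
    by (auto simp: bij_betw_def lessThan_10 mul3_def)
  then show "mul3 permutes {..<10}"
    by (rule bij_imp_permutes) (simp add: mul3_def)
next
  have translates: "mul3 ` B \<in> translates D"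
    if B: "B \<in> translates C" and C: "mul3 ` C \<in> translates D" for B C D
  proof -
    obtain k where k: "B = rot k ` C" using B unfolding translates_def by blast
    have "mul3 (rot k x) = rot (3 * k mod 10) (mul3 x)" for x
      by (simp add: rot_def mul3_def mod_simps algebra_simps)
    then have "mul3 ` B = rot (3 * k mod 10) ` mul3 ` C"
      by (simp add: k image_image)
    then show ?thesis using rot_image_translates[OF C] by simp
  qed
  have base: "mul3 ` {0, 1, 3, 4} = rot 9 ` {0, 1, 3, 4}"
    "mul3 ` {0, 1, 2, 6} = rot 6 ` {0, 2, 4, 7}"
    "mul3 ` {0, 2, 4, 7} = rot 0 ` {0, 1, 2, 6}"
    by (auto simp: rot_def mul3_def)
  have rot: "rot k ` C \<in> translates C" if "k < 10" for k C
    using that by (simp add: translates_def)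
  have "mul3 ` {0, 1, 3, 4} \<in> translates {0, 1, 3, 4}"
    "mul3 ` {0, 1, 2, 6} \<in> translates {0, 2, 4, 7}"
    "mul3 ` {0, 2, 4, 7} \<in> translates {0, 1, 2, 6}"
    unfolding base by (rule rot, simp)+
  then show "mul3 ` B \<in> blocks" if "B \<in> blocks" for B
    using that translates unfolding blocks_def by blast
qed

lemma inversion_apply:
  "inversion 0 = 0" "inversion 1 = 1" "inversion 2 = 8" "inversion 3 = 4" "inversion 4 = 3"
  "inversion 5 = 5" "inversion 6 = 7" "inversion 7 = 6" "inversion 8 = 2" "inversion 9 = 9"
  by (simp_all add: inversion_def transpose_def)

lemma inversion_block_perm: "inversion \<in> block_perms"
proof (rule block_permsI)
  show "inversion permutes {..<10}"
    unfolding inversion_def by (intro permutes_compose permutes_swap_id) auto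
  have "\<forall>B\<in>blocks. finite B \<and> set_encode (inversion ` B) \<in> set_encode ` blocks"
    unfolding block_codes by (simp add: blocks_explicit inversion_apply del: One_nat_def)
  then show "inversion ` B \<in> blocks" if "B \<in> blocks" for B
    using that block_encode[of "inversion ` B"] by blast
qed

section \<open>The graph on pairs of points\<close>

definition pairs :: "nat set set" where
  "pairs = {p. p \<subseteq> {..<10} \<and> card p = 2}"

text \<open>
  Each pair of points \<open>{a, b}\<close> is encoded as the number \<open>2 ^ a + 2 ^ b\<close>, to obtain vertices
  that are natural numbers. The two pairs in an arc are disjoint, because a block has four elements.
\<close>

definition harmonic_graph :: "nat pair_pre_digraph" where
  "harmonic_graph =
     \<lparr>pverts = set_encode ` pairs,
      parcs = {(set_encode p, set_encode q) | p q. p \<in> pairs \<and> q \<in> pairs \<and> p \<union> q \<in> blocks}\<rparr>"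

text \<open>Turns a map on pairs into an extensional map on the vertices.\<close>

definition on_codes :: "(nat set \<Rightarrow> nat set) \<Rightarrow> nat \<Rightarrow> nat" where
  "on_codes F = (\<lambda>n\<in>set_encode ` pairs. set_encode (F (set_decode n)))"

lemma finite_pairs: "finite pairs"
  by (rule finite_subset[of _ "Pow {..<10}"]) (auto simp: pairs_def)

lemma finite_pair: "p \<in> pairs \<Longrightarrow> finite p"
  by (auto simp: pairs_def intro: finite_subset)

lemma pairsE:
  assumes "p \<in> pairs"
  obtains a b where "p = {a, b}" "a < 10" "b < 10" "a \<noteq> b"
  using assms by (auto simp: pairs_def card_2_iff)

lemma pairsI: "a < 10 \<Longrightarrow> b < 10 \<Longrightarrow> a \<noteq> b \<Longrightarrow> {a, b} \<in> pairs"
  by (auto simp: pairs_def)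

lemma on_codes_apply: "p \<in> pairs \<Longrightarrow> on_codes F (set_encode p) = set_encode (F p)"
  by (simp add: on_codes_def finite_pair)

lemma inj_on_encode_pairs: "inj_on set_encode pairs"
  by (rule inj_on_subset[OF inj_on_set_encode]) (auto simp: finite_pair)

lemma encode_pair_eq_iff: "p \<in> pairs \<Longrightarrow> q \<in> pairs \<Longrightarrow> set_encode p = set_encode q \<longleftrightarrow> p = q"
  by (simp add: set_encode_eq finite_pair)

lemma arc_iff:
  "p \<in> pairs \<Longrightarrow> q \<in> pairs \<Longrightarrow> (set_encode p, set_encode q) \<in> parcs harmonic_graph \<longleftrightarrow> p \<union> q \<in> blocks"
  by (auto simp: harmonic_graph_def encode_pair_eq_iff)

lemma pair_graph_harmonic: "pair_graph harmonic_graph"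
proof
  show "finite (pverts harmonic_graph)" by (simp add: harmonic_graph_def finite_pairs)
  have "parcs harmonic_graph \<subseteq> set_encode ` pairs \<times> set_encode ` pairs"
    by (auto simp: harmonic_graph_def)
  then show "finite (parcs harmonic_graph)"
    by (rule finite_subset) (simp add: finite_pairs)
  show "fst e \<in> pverts harmonic_graph" if "e \<in> parcs harmonic_graph" for e
    using that by (auto simp: harmonic_graph_def)
  show "snd e \<in> pverts harmonic_graph" if "e \<in> parcs harmonic_graph" for e
    using that by (auto simp: harmonic_graph_def)
  show "fst e \<noteq> snd e" if e: "e \<in> parcs harmonic_graph" for e
  proof
    assume "fst e = snd e"
    then obtain p where "p \<in> pairs" "p \<union> p \<in> blocks"
      using e by (auto simp: harmonic_graph_def encode_pair_eq_iff)
    then show False using card_block[of p] by (simp add: pairs_def)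
  qed
  show "symmetric harmonic_graph"
    unfolding symmetric_def
    by (rule symI) (clarsimp simp: harmonic_graph_def, metis Un_commute)
qed

lemma image_in_pairs:
  assumes "\<pi> \<in> block_perms" "p \<in> pairs" shows "\<pi> ` p \<in> pairs"
proof -
  have \<pi>: "\<pi> permutes {..<10}" using assms by (simp add: block_perms_def)
  have "\<pi> ` p \<subseteq> {..<10}" using assms permutes_in_image[OF \<pi>] by (auto simp: pairs_def)
  moreover have "card (\<pi> ` p) = card p"
    by (rule card_image) (rule inj_on_subset[OF permutes_inj[OF \<pi>]], simp)
  ultimately show ?thesis using assms by (simp add: pairs_def)
qed

lemma image_in_blocks_iff:
  assumes "\<pi> \<in> block_perms" shows "\<pi> ` B \<in> blocks \<longleftrightarrow> B \<in> blocks"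
proof -
  have "inj \<pi>" and "(`) \<pi> ` blocks = blocks"
    using assms by (auto simp: block_perms_def dest: permutes_inj)
  then show ?thesis by (metis (no_types, lifting) image_iff inj_image_eq_iff)
qed

lemma induced_automorphism:
  assumes \<pi>: "\<pi> \<in> block_perms"
  shows "on_codes ((`) \<pi>) \<in> automorphisms harmonic_graph"
proof -
  let ?V = "set_encode ` pairs" and ?g = "on_codes ((`) \<pi>)"
  have "inj \<pi>" using \<pi> by (auto simp: block_perms_def dest: permutes_inj)
  have "inj_on ?g ?V"
    using \<open>inj \<pi>\<close>
    by (auto intro!: inj_onI simp: on_codes_apply encode_pair_eq_iff image_in_pairs[OF \<pi>] inj_image_eq_iff)
  moreover have "?g ` ?V \<subseteq> ?V"
    by (auto simp: on_codes_apply image_in_pairs[OF \<pi>])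
  ultimately have "?g \<in> Bij ?V"
    by (simp add: Bij_def bij_betw_def endo_inj_surj finite_pairs on_codes_def)
  moreover have "(?g x, ?g y) \<in> parcs harmonic_graph \<longleftrightarrow> (x, y) \<in> parcs harmonic_graph"
    if "x \<in> ?V" "y \<in> ?V" for x y
    using that image_in_pairs[OF \<pi>] image_in_blocks_iff[OF \<pi>]
    by (auto simp: on_codes_apply arc_iff image_Un[symmetric])
  ultimately show ?thesis by (simp add: automorphisms_def harmonic_graph_def)
qed

section \<open>Triple transitivity\<close>

text \<open>
  The first point is moved to \<open>0\<close> by a translation. For the second, permutations fixing \<open>0\<close>
  are needed: \<^const>\<open>mul3\<close> has the orbits \<open>{1, 3, 9, 7}\<close>, \<open>{2, 6, 8, 4}\<close> and
  \<open>{5}\<close>, the inversion joins the first two, and its conjugate by the translation by 1, which swaps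
  \<open>4\<close> and \<open>5\<close>, joins the third. Since \<^const>\<open>mul3\<close> and the inversion also fix
  \<open>5\<close>, they move the third point to \<open>1\<close>. The predicates \<open>P\<close> and \<open>Q\<close> in the proof say that
  a point can be moved to \<open>5\<close> and to \<open>1\<close> in this way.
\<close>

lemma triple_to_standard:
  assumes "a < 10" "b < 10" "c < 10" "a \<noteq> b" "a \<noteq> c" "b \<noteq> c"
  obtains \<pi> where "\<pi> \<in> block_perms" "\<pi> a = 0" "\<pi> b = 5" "\<pi> c = 1"
proof -
  define P where "P b \<longleftrightarrow> (\<exists>\<pi>\<in>block_perms. \<pi> 0 = 0 \<and> \<pi> b = 5)" for b :: nat
  define Q where "Q c \<longleftrightarrow> (\<exists>\<pi>\<in>block_perms. \<pi> 0 = 0 \<and> \<pi> 5 = 5 \<and> \<pi> c = 1)" for c :: nat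
  have id: "id \<in> block_perms" by (simp add: block_perms_def permutes_id)
  have P_step: "P x" if \<sigma>: "\<sigma> \<in> block_perms" "\<sigma> 0 = 0" "P (\<sigma> x)" for \<sigma> x
  proof -
    obtain \<pi> where "\<pi> \<in> block_perms" "\<pi> 0 = 0" "\<pi> (\<sigma> x) = 5"
      using \<sigma> unfolding P_def by blast
    then show ?thesis
      unfolding P_def using \<sigma> by (intro bexI[of _ "\<pi> \<circ> \<sigma>"]) (simp_all add: block_perms_comp)
  qed
  have Q_step: "Q x" if \<sigma>: "\<sigma> \<in> block_perms" "\<sigma> 0 = 0" "\<sigma> 5 = 5" "Q (\<sigma> x)" for \<sigma> x
  proof -
    obtain \<pi> where "\<pi> \<in> block_perms" "\<pi> 0 = 0" "\<pi> 5 = 5" "\<pi> (\<sigma> x) = 1"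
      using \<sigma> unfolding Q_def by blast
    then show ?thesis
      unfolding Q_def using \<sigma> by (intro bexI[of _ "\<pi> \<circ> \<sigma>"]) (simp_all add: block_perms_comp)
  qed
  have P_mul: "P x" if "P (mul3 x)" for x
    by (rule P_step[OF mul3_block_perm _ that]) (simp_all add: mul3_def)
  have Q_mul: "Q x" if "Q (mul3 x)" for x
    by (rule Q_step[OF mul3_block_perm _ _ that]) (simp_all add: mul3_def)
  have P_inversion: "P x" if "P (inversion x)" for x
    by (rule P_step[OF inversion_block_perm _ that]) (simp_all add: inversion_apply)
  have Q_inversion: "Q x" if "Q (inversion x)" for x
    by (rule Q_step[OF inversion_block_perm _ _ that]) (simp_all add: inversion_apply)
  have "rot 1 \<circ> (inversion \<circ> rot 9) \<in> block_perms"
    by (intro block_perms_comp rot_block_perm inversion_block_perm)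
  then have P_shift: "P x" if "P (rot 1 (inversion (rot 9 x)))" for x
    using that P_step[of "rot 1 \<circ> (inversion \<circ> rot 9)" x] by (simp add: rot_def inversion_apply)
  have "P 5" unfolding P_def using id by (intro bexI[of _ id]) auto
  then have "P 4" using P_shift[of 4] by (simp add: rot_def inversion_apply)
  then have "P 8" using P_mul[of 8] by (simp add: mul3_def)
  then have "P 6" using P_mul[of 6] by (simp add: mul3_def)
  then have "P 2" using P_mul[of 2] by (simp add: mul3_def)
  have "P 3" using \<open>P 4\<close> P_inversion[of 3] by (simp add: inversion_apply)
  then have "P 1" using P_mul[of 1] by (simp add: mul3_def)
  then have "P 7" using P_mul[of 7] by (simp add: mul3_def)
  then have "P 9" using P_mul[of 9] by (simp add: mul3_def)
  have P: "P x" if "x < 10" "x \<noteq> 0" for x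
  proof -
    have "x \<in> {1, 2, 3, 4, 5, 6, 7, 8, 9}" using that by auto
    then show ?thesis
      using \<open>P 1\<close> \<open>P 2\<close> \<open>P 3\<close> \<open>P 4\<close> \<open>P 5\<close> \<open>P 6\<close> \<open>P 7\<close> \<open>P 8\<close> \<open>P 9\<close> by blast
  qed
  have "Q 1" unfolding Q_def using id by (intro bexI[of _ id]) auto
  then have "Q 7" using Q_mul[of 7] by (simp add: mul3_def)
  then have "Q 9" using Q_mul[of 9] by (simp add: mul3_def)
  then have "Q 3" using Q_mul[of 3] by (simp add: mul3_def)
  then have "Q 4" using Q_inversion[of 4] by (simp add: inversion_apply)
  then have "Q 8" using Q_mul[of 8] by (simp add: mul3_def)
  then have "Q 6" using Q_mul[of 6] by (simp add: mul3_def)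
  then have "Q 2" using Q_mul[of 2] by (simp add: mul3_def)
  have Q: "Q x" if "x < 10" "x \<noteq> 0" "x \<noteq> 5" for x
  proof -
    have "x \<in> {1, 2, 3, 4, 6, 7, 8, 9}" using that by auto
    then show ?thesis
      using \<open>Q 1\<close> \<open>Q 2\<close> \<open>Q 3\<close> \<open>Q 4\<close> \<open>Q 6\<close> \<open>Q 7\<close> \<open>Q 8\<close> \<open>Q 9\<close> by blast
  qed
  have inj: "\<pi> x = \<pi> y \<longleftrightarrow> x = y" if "\<pi> \<in> block_perms" for \<pi> x y
    using that by (auto simp: block_perms_def dest: permutes_inj injD)
  have range: "\<pi> x < 10 \<longleftrightarrow> x < 10" if "\<pi> \<in> block_perms" for \<pi> x
    using that permutes_in_image[of \<pi> "{..<10}" x] by (auto simp: block_perms_def)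
  obtain \<rho> where \<rho>: "\<rho> \<in> block_perms" "\<rho> a = 0"
    using rot_block_perm[of "10 - a"] assms(1) by (auto simp: rot_def)
  have "P (\<rho> b)" using P[of "\<rho> b"] \<rho> inj[of \<rho> b a] range[of \<rho> b] assms by auto
  then obtain \<sigma> where \<sigma>: "\<sigma> \<in> block_perms" "\<sigma> 0 = 0" "\<sigma> (\<rho> b) = 5" by (auto simp: P_def)
  let ?c = "\<sigma> (\<rho> c)"
  have "?c \<noteq> \<sigma> (\<rho> a)" "?c \<noteq> \<sigma> (\<rho> b)" "?c < 10"
    using assms by (auto simp: inj range \<rho>(1) \<sigma>(1))
  then have "Q ?c" using Q[of ?c] \<rho> \<sigma> by auto
  then obtain \<tau> where "\<tau> \<in> block_perms" "\<tau> 0 = 0" "\<tau> 5 = 5" "\<tau> ?c = 1" by (auto simp: Q_def)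
  then show ?thesis
    using that[of "\<tau> \<circ> (\<sigma> \<circ> \<rho>)"] \<rho> \<sigma> by (auto intro: block_perms_comp)
qed

lemma triply_transitive:
  assumes "a < 10" "b < 10" "c < 10" "a \<noteq> b" "a \<noteq> c" "b \<noteq> c"
    and "a' < 10" "b' < 10" "c' < 10" "a' \<noteq> b'" "a' \<noteq> c'" "b' \<noteq> c'"
  obtains \<pi> where "\<pi> \<in> block_perms" "\<pi> a = a'" "\<pi> b = b'" "\<pi> c = c'"
proof -
  obtain \<rho> where \<rho>: "\<rho> \<in> block_perms" "\<rho> a = 0" "\<rho> b = 5" "\<rho> c = 1"
    using triple_to_standard assms by metis
  obtain \<sigma> where \<sigma>: "\<sigma> \<in> block_perms" "\<sigma> a' = 0" "\<sigma> b' = 5" "\<sigma> c' = 1"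
    using triple_to_standard assms by metis
  have "inj \<sigma>" using \<sigma>(1) by (auto simp: block_perms_def dest: permutes_inj)
  have "inv_into UNIV \<sigma> 0 = a'" "inv_into UNIV \<sigma> 5 = b'" "inv_into UNIV \<sigma> 1 = c'"
    using inv_f_f[OF \<open>inj \<sigma>\<close>] \<sigma> by metis+
  then show ?thesis
    using that[of "inv_into UNIV \<sigma> \<circ> \<rho>"] \<rho> block_perms_comp[OF block_perms_inv[OF \<sigma>(1)] \<rho>(1)]
    by simp
qed

section \<open>Primitivity\<close>

lemma pair_transitive:
  assumes "p \<in> pairs" "q \<in> pairs"
  obtains \<pi> where "\<pi> \<in> block_perms" "\<pi> ` p = q"
proof -
  obtain a b where p: "p = {a, b}" "a < 10" "b < 10" "a \<noteq> b" by (rule pairsE[OF assms(1)])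
  obtain a' b' where q: "q = {a', b'}" "a' < 10" "b' < 10" "a' \<noteq> b'" by (rule pairsE[OF assms(2)])
  have third: "\<exists>c<10. x \<noteq> c \<and> y \<noteq> c" for x y :: nat
  proof -
    have "\<not> {0, 1, 2} \<subseteq> {x, y}"
      using card_mono[of "{x, y}" "{0, 1, 2}"] by (auto simp: card_insert_if split: if_splits)
    then obtain c where "c \<in> {0, 1, 2}" "c \<notin> {x, y}" by blast
    then show ?thesis by (intro exI[of _ c]) auto
  qed
  obtain c where "c < 10" "a \<noteq> c" "b \<noteq> c" using third by blast
  moreover obtain c' where "c' < 10" "a' \<noteq> c'" "b' \<noteq> c'" using third by blast
  ultimately obtain \<pi> where "\<pi> \<in> block_perms" "\<pi> a = a'" "\<pi> b = b'"
    using p q triply_transitive[of a b c a' b' c'] by blast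
  then show ?thesis using that p q by auto
qed

text \<open>
  It suffices to find two distinct related pairs that share a point. Starting from disjoint related
  pairs \<open>{0, 5}\<close> and \<open>{1, x}\<close>, the images of \<open>{1, x}\<close> under permutations that
  preserve \<open>{0, 5}\<close>, namely the translation by 5, \<^const>\<open>mul3\<close> and the inversion, remain in the same
  class. For \<open>x \<noteq> 9\<close> two of these images share a point. For \<open>x = 9\<close> the pairs are adjacent
  in the graph and the images are only the four neighbours of \<open>{0, 5}\<close>; an automorphism moving
  \<open>{0, 5}\<close> to one of them, \<open>{2, 8}\<close>, then yields a further pair in the class.
\<close>

lemma invariant_equivalence_total:
  assumes r: "equiv pairs r"
    and inv: "\<And>\<pi> p q. \<pi> \<in> block_perms \<Longrightarrow> (p, q) \<in> r \<Longrightarrow> (\<pi> ` p, \<pi> ` q) \<in> r"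
    and nontrivial: "(p, q) \<in> r" "p \<noteq> q"
  shows "r = pairs \<times> pairs"
proof -
  have sub: "r \<subseteq> pairs \<times> pairs" using r by (rule equiv_type)
  have refl: "(x, x) \<in> r" if "x \<in> pairs" for x
    using r that by (auto simp: equiv_def refl_on_def)
  have sym: "(y, x) \<in> r" if "(x, y) \<in> r" for x y
    using r that by (auto simp: equiv_def dest: symD)
  have trans: "(x, z) \<in> r" if "(x, y) \<in> r" "(y, z) \<in> r" for x y z
    using r that by (auto simp: equiv_def dest: transD)
  have total: "r = pairs \<times> pairs"
    if meet: "({a, b}, {a, c}) \<in> r" "b \<noteq> c" for a b c
  proof -
    have "{a, b} \<in> pairs" "{a, c} \<in> pairs" using meet sub by auto
    then have abc: "a < 10" "b < 10" "c < 10" "a \<noteq> b" "a \<noteq> c"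
      by (auto simp: pairs_def card_insert_if split: if_splits)
    have adjacent: "({x, y}, {x, z}) \<in> r"
      if xyz: "x < 10" "y < 10" "z < 10" "x \<noteq> y" "x \<noteq> z" for x y z
    proof (cases "y = z")
      case True
      then show ?thesis using refl pairsI xyz by simp
    next
      case False
      then obtain \<pi> where \<pi>: "\<pi> \<in> block_perms" "\<pi> a = x" "\<pi> b = y" "\<pi> c = z"
        using triply_transitive abc meet(2) xyz by metis
      then show ?thesis using inv[OF \<pi>(1) meet(1)] by simp
    qed
    have "(p, q) \<in> r" if pq: "p \<in> pairs" "q \<in> pairs" for p q
    proof -
      obtain x y where p: "p = {x, y}" "x < 10" "y < 10" "x \<noteq> y" by (rule pairsE[OF pq(1)])
      obtain u v where q: "q = {u, v}" "u < 10" "v < 10" "u \<noteq> v" by (rule pairsE[OF pq(2)])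
      show ?thesis
      proof (cases "x = u")
        case True
        then show ?thesis using adjacent[of x y v] p q by simp
      next
        case False
        then have "({x, y}, {x, u}) \<in> r" "({u, x}, {u, v}) \<in> r"
          using adjacent p q by auto
        then show ?thesis using trans[of "{x, y}" "{x, u}"] p q by (simp add: insert_commute)
      qed
    qed
    then show ?thesis using sub by auto
  qed
  have "p \<in> pairs" "q \<in> pairs" using nontrivial sub by auto
  obtain a b where p: "p = {a, b}" "a < 10" "b < 10" "a \<noteq> b" by (rule pairsE[OF \<open>p \<in> pairs\<close>])
  obtain c d where q: "q = {c, d}" "c < 10" "d < 10" "c \<noteq> d" by (rule pairsE[OF \<open>q \<in> pairs\<close>])
  show ?thesis
  proof (cases "{a, b} \<inter> {c, d} = {}")
    case False
    then obtain z where z: "z \<in> p" "z \<in> q" using p q by blast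
    obtain v where v: "p = {z, v}" using z(1) p(1) by blast
    obtain w where w: "q = {z, w}" using z(2) q(1) by blast
    show ?thesis using nontrivial total[of z v w] v w by blast
  next
    case True
    then have "a \<noteq> c" "b \<noteq> c" by auto
    then obtain \<pi> where \<pi>: "\<pi> \<in> block_perms" "\<pi> a = 0" "\<pi> b = 5" "\<pi> c = 1"
      using triple_to_standard p q by blast
    define x where "x = \<pi> d"
    have perm: "\<pi> permutes {..<10}" using \<pi>(1) by (simp add: block_perms_def)
    have base: "({0, 5}, {1, x}) \<in> r"
      using inv[OF \<pi>(1) nontrivial(1)] p q \<pi> by (simp add: x_def)
    have "x < 10" using permutes_in_image[OF perm, of d] q by (simp add: x_def)
    moreover have "x \<noteq> \<pi> a" "x \<noteq> \<pi> b" "x \<noteq> \<pi> c"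
      using True q by (auto simp: x_def inj_eq[OF permutes_inj[OF perm]])
    ultimately have x: "x \<in> {2, 3, 4, 6, 7, 8, 9}" by (auto simp: \<pi>)
    have rot5: "({0, 5}, rot 5 ` q) \<in> r" if "({0, 5}, q) \<in> r" for q
      using inv[OF rot_block_perm that, of 5] by (simp add: rot_def insert_commute)
    have mul3: "({0, 5}, mul3 ` q) \<in> r" if "({0, 5}, q) \<in> r" for q
      using inv[OF mul3_block_perm that] by (simp add: mul3_def)
    have inversion: "({0, 5}, inversion ` q) \<in> r" if "({0, 5}, q) \<in> r" for q
      using inv[OF inversion_block_perm that] by (simp add: inversion_apply)
    have total': "r = pairs \<times> pairs"
      if "({0, 5}, {u, v}) \<in> r" "({0, 5}, {u, w}) \<in> r" "v \<noteq> w" for u v w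
      using total[of u v w] trans[OF sym[OF that(1)] that(2)] that(3) by simp
    have shifted: "({0, 5}, {rot 5 1, rot 5 x}) \<in> r" using rot5[OF base] by simp
    have tripled: "({0, 5}, {mul3 1, mul3 x}) \<in> r" using mul3[OF base] by simp
    have inverted: "({0, 5}, {1, inversion x}) \<in> r"
      using inversion[OF base] by (simp add: inversion_apply del: One_nat_def)
    from x consider "x = 2" | "x = 3" | "x = 4 \<or> x = 6" | "x = 7" | "x = 8" | "x = 9" by blast
    then show ?thesis
    proof cases
      case 1
      then show ?thesis using total'[of 6 7 3] shifted tripled
        by (simp add: rot_def mul3_def insert_commute)
    next
      case 2
      then show ?thesis using total'[of 3 1 9] base tripled
        by (simp add: mul3_def insert_commute)
    next
      case 3
      then show ?thesis using total'[of 1 x "inversion x"] base inverted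
        by (auto simp: inversion_apply)
    next
      case 4
      then show ?thesis using total'[of 1 7 3] base tripled
        by (simp add: mul3_def insert_commute)
    next
      case 5
      then show ?thesis using total'[of 3 4 6] shifted tripled
        by (simp add: rot_def mul3_def insert_commute)
    next
      case 6
      have "({0, 5}, {3, 7}) \<in> r" using tripled 6 by (simp add: mul3_def)
      moreover have "({0, 5}, {2, 8}) \<in> r"
        using mul3[OF rot5[OF base]] 6 by (simp add: mul3_def rot_def insert_commute)
      \<comment> \<open>The translation by 1, the inversion and again the translation by 1 together map
        \<open>{0, 5}\<close> to \<open>{2, 8}\<close>, which lies in the class of \<open>{0, 5}\<close>, and \<open>{3, 7}\<close> to \<open>{3, 4}\<close>.\<close>
      moreover have "({2, 8}, {3, 4}) \<in> r"
        using inv[OF rot_block_perm inv[OF inversion_block_perm inv[OF rot_block_perm \<open>({0, 5}, {3, 7}) \<in> r\<close>]], of 1 1]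
        by (simp add: rot_def inversion_apply numeral_2_eq_2[symmetric] insert_commute del: One_nat_def)
      ultimately show ?thesis using total'[of 3 7 4] trans by auto
    qed
  qed
qed

lemma primitive_graph_harmonic: "primitive_graph harmonic_graph"
proof (rule primitive_graphI[OF pair_graph_harmonic])
  let ?V = "pverts harmonic_graph"
  have V: "?V = set_encode ` pairs" by (simp add: harmonic_graph_def)
  show "\<exists>g\<in>automorphisms harmonic_graph. g x = y" if xy: "x \<in> ?V" "y \<in> ?V" for x y
  proof -
    obtain p q where pq: "p \<in> pairs" "q \<in> pairs" "x = set_encode p" "y = set_encode q"
      using xy V by auto
    then obtain \<pi> where \<pi>: "\<pi> \<in> block_perms" "\<pi> ` p = q" using pair_transitive by blast
    then show ?thesis
      using pq induced_automorphism[OF \<pi>(1)] by (intro bexI[of _ "on_codes ((`) \<pi>)"]) (simp_all add: on_codes_apply)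
  qed
  fix r assume r: "equiv ?V r" and inv: "preserves_relation (automorphisms harmonic_graph) r"
    and nontrivial: "r \<noteq> Id_on ?V"
  define s where "s = {(p, q). p \<in> pairs \<and> q \<in> pairs \<and> (set_encode p, set_encode q) \<in> r}"
  have sub: "r \<subseteq> ?V \<times> ?V" using r by (rule equiv_type)
  have refl: "(x, x) \<in> r" if "x \<in> ?V" for x
    using r that by (auto simp: equiv_def refl_on_def)
  have "equiv pairs s"
  proof (rule equivI)
    show "s \<subseteq> pairs \<times> pairs" by (auto simp: s_def)
    show "refl_on pairs s" using refl V by (auto simp: s_def refl_on_def)
    show "sym s" using r by (auto simp: s_def equiv_def sym_def)
    show "trans s" using r unfolding s_def equiv_def trans_def by blast
  qed
  moreover have "(\<pi> ` p, \<pi> ` q) \<in> s" if "\<pi> \<in> block_perms" "(p, q) \<in> s" for \<pi> p q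
  proof -
    have "(on_codes ((`) \<pi>) (set_encode p), on_codes ((`) \<pi>) (set_encode q)) \<in> r"
      using inv induced_automorphism[OF that(1)] that(2)
      unfolding preserves_relation_def s_def by blast
    then show ?thesis using that by (simp add: s_def on_codes_apply image_in_pairs)
  qed
  moreover obtain p q where "(p, q) \<in> s" "p \<noteq> q"
  proof -
    obtain x y where "(x, y) \<in> r" "x \<noteq> y"
      using nontrivial sub refl by (auto simp: Id_on_def)
    moreover obtain p q where "p \<in> pairs" "q \<in> pairs" "x = set_encode p" "y = set_encode q"
      using \<open>(x, y) \<in> r\<close> sub V by auto
    ultimately show ?thesis using that[of p q] by (auto simp: s_def)
  qed
  ultimately have "s = pairs \<times> pairs" by (rule invariant_equivalence_total)
  then show "r = ?V \<times> ?V" using sub V by (auto simp: s_def)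
qed

section \<open>Folding the graph onto a butterfly\<close>

definition even_translates :: "nat set \<Rightarrow> nat set set" where
  "even_translates B = (\<lambda>k. rot (2 * k) ` B) ` {..<5}"

text \<open>
  The butterfly has the centre \<open>{0, 5}\<close> and the wings \<open>{3, 7}\<close>, \<open>{4, 6}\<close> and
  \<open>{1, 9}\<close>, \<open>{2, 8}\<close>. The map is constant on the orbits of the even translations; such an
  orbit consists of the pairs \<open>{x, x + d}\<close> with a fixed difference \<open>d\<close> and, if
  \<open>d\<close> is not 5, a fixed parity of \<open>x\<close>. The graph has 30 triangles, in three families:
  \<^item> two pairs of difference 1, with \<open>x\<close> even and odd, and one of difference 4;
  \<^item> two pairs of difference 3, with \<open>x\<close> even and odd, and one of difference 2;
  \<^item> one pair each of the differences 2, 4 and 5.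

  The fibre of the centre consists of the pairs of difference 2 and those of difference 1 with \<open>x\<close>
  even; it contains one pair of each triangle. The second family is folded onto the first wing, and the two
  other families are folded onto the second wing. The last branch collects the pairs of difference 5 and those of
  difference 1 with \<open>x\<close> odd.
\<close>

definition fold_pair :: "nat set \<Rightarrow> nat set" where
  "fold_pair p =
     (if p \<in> translates {0, 2} \<union> even_translates {0, 1} then {0, 5}
      else if p \<in> even_translates {0, 3} then {3, 7}
      else if p \<in> even_translates {1, 4} then {4, 6}
      else if p \<in> translates {0, 4} then {2, 8}
      else {1, 9})"

lemma even_translates_eq:
  "even_translates B = {rot 0 ` B, rot 2 ` B, rot 4 ` B, rot 6 ` B, rot 8 ` B}"
  by (simp add: even_translates_def lessThan_nat_numeral lessThan_Suc insert_commute)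

lemma fold_classes:
  "translates {0, 2} = {{0, 2}, {1, 3}, {2, 4}, {3, 5}, {4, 6}, {5, 7}, {6, 8}, {7, 9}, {8, 0}, {9, 1}}"
  "translates {0, 4} = {{0, 4}, {1, 5}, {2, 6}, {3, 7}, {4, 8}, {5, 9}, {6, 0}, {7, 1}, {8, 2}, {9, 3}}"
  "even_translates {0, 1} = {{0, 1}, {2, 3}, {4, 5}, {6, 7}, {8, 9}}"
  "even_translates {0, 3} = {{0, 3}, {2, 5}, {4, 7}, {6, 9}, {8, 1}}"
  "even_translates {1, 4} = {{1, 4}, {3, 6}, {5, 8}, {7, 0}, {9, 2}}"
  by (simp_all add: translates_eq even_translates_eq rot_def numeral_2_eq_2[symmetric] del: One_nat_def)

lemma fold_pair_in_pairs: "fold_pair p \<in> pairs"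
  by (simp add: fold_pair_def pairsI)

lemma butterfly_blocks:
  "{0, 5, 3, 7} \<in> blocks" "{0, 5, 4, 6} \<in> blocks" "{0, 5, 2, 8} \<in> blocks" "{0, 5, 1, 9} \<in> blocks"
  "{3, 7, 0, 5} \<in> blocks" "{4, 6, 0, 5} \<in> blocks" "{2, 8, 0, 5} \<in> blocks" "{1, 9, 0, 5} \<in> blocks"
  "{3, 7, 4, 6} \<in> blocks" "{4, 6, 3, 7} \<in> blocks" "{1, 9, 2, 8} \<in> blocks" "{2, 8, 1, 9} \<in> blocks"
  by (rule block_encode; simp add: block_codes del: One_nat_def)+

text \<open>
  Unlike the definition, this instance does not rewrite until the argument has been evaluated to a
  doubleton, which keeps the simplifier from duplicating large unevaluated arguments.
\<close>

lemma fold_pair_doubleton: "fold_pair {a, b} =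
     (if {a, b} \<in> translates {0, 2} \<union> even_translates {0, 1} then {0, 5}
      else if {a, b} \<in> even_translates {0, 3} then {3, 7}
      else if {a, b} \<in> even_translates {1, 4} then {4, 6}
      else if {a, b} \<in> translates {0, 4} then {2, 8}
      else {1, 9})"
  by (simp only: fold_pair_def)

text \<open>
  An edge is a splitting of a block into two pairs, so the endomorphism property is a check of the
  splittings of the 30 blocks.
\<close>

lemma fold_pair_block:
  assumes "B \<in> blocks" "p \<subseteq> B" "card p = 2"
  shows "fold_pair p \<union> fold_pair (B - p) \<in> blocks"
proof -
  have "\<forall>p\<in>Pow B. card p = 2 \<longrightarrow> fold_pair p \<union> fold_pair (B - p) \<in> blocks"
    using assms(1)[unfolded blocks_explicit]
    by (elim insertE emptyE; hypsubst_thin;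
        simp add: Pow_insert butterfly_blocks fold_pair_doubleton fold_classes doubleton_eq_iff
          insert_Diff_if del: One_nat_def)
  then show ?thesis using assms by blast
qed

lemma fold_endomorphism: "on_codes fold_pair \<in> endomorphisms harmonic_graph"
proof -
  have V: "pverts harmonic_graph = set_encode ` pairs" by (simp add: harmonic_graph_def)
  have maps: "on_codes fold_pair \<in> transformations (set_encode ` pairs)"
    by (auto simp: PiE_def on_codes_apply fold_pair_in_pairs) (simp add: on_codes_def)
  have edge: "fold_pair p \<union> fold_pair q \<in> blocks"
    if pq: "p \<in> pairs" "q \<in> pairs" "p \<union> q \<in> blocks" for p q
  proof -
    have "finite (p \<inter> q)" and card: "card p + card q = card (p \<union> q) + card (p \<inter> q)"
      using finite_pair[OF pq(1)] finite_pair[OF pq(2)] by (simp, rule card_Un_Int)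
    have "card p = 2" "card q = 2" using pq by (simp_all add: pairs_def)
    then have "card (p \<inter> q) = 0" using card card_block[OF pq(3)] by simp
    then have "p \<inter> q = {}" using \<open>finite (p \<inter> q)\<close> by simp
    then have "(p \<union> q) - p = q" by blast
    then show ?thesis using fold_pair_block[OF pq(3), of p] \<open>card p = 2\<close> by simp
  qed
  have "(on_codes fold_pair x, on_codes fold_pair y) \<in> parcs harmonic_graph"
    if xy: "(x, y) \<in> parcs harmonic_graph" for x y
  proof -
    obtain p q where "p \<in> pairs" "q \<in> pairs" "p \<union> q \<in> blocks" "x = set_encode p" "y = set_encode q"
      using xy by (auto simp: harmonic_graph_def)
    then show ?thesis
      using edge[of p q]
      by (simp add: on_codes_apply arc_iff fold_pair_in_pairs)
  qed
  then show ?thesis using maps by (auto simp: endomorphisms_def V)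
qed

text \<open>
  The ten pairs of difference 2 lie in the kernel class of \<open>{0, 2}\<close>, while the class of
  \<open>{0, 3}\<close> consists of even translates of \<open>{0, 3}\<close>, of which there are five.
\<close>

lemma fold_not_uniform: "\<not> uniform (pverts harmonic_graph) (on_codes fold_pair)"
proof
  let ?V = "set_encode ` pairs" and ?f = "on_codes fold_pair"
  let ?class = "\<lambda>p. {(x, y) \<in> ?V \<times> ?V. ?f x = ?f y} `` {set_encode p}"
  have V: "pverts harmonic_graph = ?V" by (simp add: harmonic_graph_def)
  have in_kernel: "?class p \<in> kernel_partition ?V ?f" if "p \<in> pairs" for p
    unfolding kernel_partition_def using that by (intro quotientI) simp
  have class_eq: "?class p = set_encode ` {q \<in> pairs. fold_pair q = fold_pair p}" if "p \<in> pairs" for p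
    using that by (auto simp: on_codes_apply encode_pair_eq_iff fold_pair_in_pairs)
  have card_class: "card (?class p) = card {q \<in> pairs. fold_pair q = fold_pair p}" if "p \<in> pairs" for p
    unfolding class_eq[OF that] by (rule card_image) (rule inj_on_subset[OF inj_on_encode_pairs], auto)
  have zero_three: "{0, 3} \<in> pairs" and zero_two: "{0, 2} \<in> pairs" by (simp_all add: pairsI)
  have "fold_pair {0, 3} = {3, 7}"
    by (simp add: fold_pair_def fold_classes doubleton_eq_iff del: One_nat_def)
  then have "{q \<in> pairs. fold_pair q = fold_pair {0, 3}} \<subseteq> even_translates {0, 3}"
    by (auto simp: fold_pair_def doubleton_eq_iff split: if_splits)
  then have "card (?class {0, 3}) \<le> card (even_translates {0, 3})"
    unfolding card_class[OF zero_three] by (rule card_mono[rotated]) (simp add: even_translates_def)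
  also have "\<dots> \<le> 5" unfolding even_translates_def using card_image_le[of "{..<5::nat}"] by fastforce
  finally have small: "card (?class {0, 3}) \<le> 5" .
  have "fold_pair q = {0, 5}" if "q \<in> translates {0, 2}" for q
    using that by (simp add: fold_pair_def)
  moreover have "{0, 2} \<in> translates {0, 2}" by (simp add: fold_classes)
  moreover have "translates {0, 2} \<subseteq> pairs" unfolding fold_classes by (simp add: pairsI)
  ultimately have "translates {0, 2} \<subseteq> {q \<in> pairs. fold_pair q = fold_pair {0, 2}}" by blast
  then have "card (translates {0, 2}) \<le> card (?class {0, 2})"
    unfolding card_class[OF zero_two] by (rule card_mono[rotated]) (simp add: finite_pairs)
  moreover have "card (translates {0, 2}) = 10"
    by (simp add: fold_classes doubleton_eq_iff)
  moreover assume "uniform (pverts harmonic_graph) ?f"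
  then have "card (?class {0, 3}) = card (?class {0, 2})"
    using in_kernel[OF zero_three] in_kernel[OF zero_two] unfolding uniform_def V by blast
  ultimately show False using small by linarith
qed

section \<open>Primitive groups that are not almost synchronizing\<close>

theorem theorem1p1:
  shows "(\<exists>\<Gamma> :: nat pair_pre_digraph.
            primitive_graph \<Gamma> \<and> non_null \<Gamma> \<and>
            (\<exists>f\<in>endomorphisms \<Gamma>. \<not> uniform (pverts \<Gamma>) f)) \<and>
         \<not> (\<forall>(\<Omega> :: nat set) G. primitive_group \<Omega> G \<longrightarrow> almost_synchronizing \<Omega> G)"
proof
  let ?\<Gamma> = harmonic_graph and ?f = "on_codes fold_pair"
  have "(set_encode {0, 5}, set_encode {3, 7}) \<in> parcs ?\<Gamma>"
    by (subst arc_iff) (simp_all add: pairsI butterfly_blocks)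
  then have non_null: "non_null ?\<Gamma>" by (auto simp: non_null_def)
  then show "\<exists>\<Gamma> :: nat pair_pre_digraph. primitive_graph \<Gamma> \<and> non_null \<Gamma> \<and>
      (\<exists>f\<in>endomorphisms \<Gamma>. \<not> uniform (pverts \<Gamma>) f)"
    using primitive_graph_harmonic fold_endomorphism fold_not_uniform by blast
  obtain G where G: "G \<subseteq> automorphisms ?\<Gamma>" "primitive_group (pverts ?\<Gamma>) G"
    using primitive_graph_harmonic by (auto simp: primitive_graph_def)
  have "?f \<in> transformations (pverts ?\<Gamma>)"
    using fold_endomorphism by (simp add: endomorphisms_def)
  then have "\<not> almost_synchronizing (pverts ?\<Gamma>) G"
    using fold_not_uniform
      endomorphism_not_synchronized[OF pair_graph_harmonic non_null G(1) fold_endomorphism]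
    by (auto simp: almost_synchronizing_def)
  then show "\<not> (\<forall>(\<Omega> :: nat set) G. primitive_group \<Omega> G \<longrightarrow> almost_synchronizing \<Omega> G)"
    using G(2) by blast
qed

end
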